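(* Let $d\ge1$, fix $p_0\in(0,1/2)$ and a nonnegative witness weight system $w=(w_{I,\sigma})_{(I,\sigma)\in\mathcal G_d}$ with $m_0=1-p_0\sum_{(I,\sigma)\in\mathcal G_d}w_{I,\sigma}\ge0$. Let $U=(U_1,\dots,U_d)$ be the corresponding canonical witness realization at scale $p_0$. Then for every nonempty $J\subseteq[d]$, every $\tau\in\{\mathrm L,\mathrm U\}^J$ and every $0<p\le p_0$, $$\lambda^{(p)}_{J,\tau}(U)=\sum_{I\supseteq J}\ \sum_{\sigma\in\{\mathrm L,\mathrm U\}^I:\,\sigma|_J=\tau}w_{I,\sigma}=\lambda_{J,\tau}.$$ In particular, $\lambda^{(p)}=\lambda$ for all $0<p\le p_0$.
   Context: $[d]=\{1,\dots,d\}$; $\mathcal G_d=\{(I,\sigma):\emptyset\ne I\subseteq[d],\ \sigma\in\{\mathrm L,\mathrm U\}^I\}$, where $\{\mathrm L,\mathrm U\}^I$ is the set of functions $I\to\{\mathrm L,\mathrm U\}$. The complete signed tail family of the weight system $w$ is $\lambda_{J,\tau}=\sum_{(I,\sigma)\in\mathcal G_d:\,I\supseteq J,\,\sigma|_J=\tau}w_{I,\sigma}$. Canonical witness realization. For $(I,\sigma)\in\mathcal G_d$ let $\mu_{I,\sigma}^{(p_0)}$ be the law of $(U_1,\dots,U_d)$ with $U_i=p_0Z$ if $i\in I,\sigma_i=\mathrm L$; $U_i=1-p_0Z$ if $i\in I,\sigma_i=\mathrm U$; $U_i=p_0+(1-2p_0)V_i$ if $i\notin I$, where $Z$ and the $V_i$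 are independent and uniform on $[0,1]$. Let $\mu_0^{(p_0)}$ be the law of $(p_0+(1-2p_0)V_i)_{i=1}^d$ with $V_i$ i.i.d. uniform on $[0,1]$. The canonical witness realization of $w$ at scale $p_0$ is a random vector with law $\mu^{(w,p_0)}=m_0\mu_0^{(p_0)}+\sum_{(I,\sigma)\in\mathcal G_d}p_0w_{I,\sigma}\,\mu_{I,\sigma}^{(p_0)}$. Finite-threshold coefficient. For a random vector $U$ in $[0,1]^d$, put $D_i^{(\tau)}=U_i$ if $\tau_i=\mathrm L$ and $D_i^{(\tau)}=1-U_i$ if $\tau_i=\mathrm U$ ($i\in J$), and $\lambda^{(p)}_{J,\tau}(U)=\frac1p\Pr(D_i^{(\tau)}\le p\text{ for all }i\in J)$. *)

theory Defs
  imports "HOL-Probability.Probability"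
begin

datatype side = Lower | Upper

definition signed_subsets :: "nat \<Rightarrow> (nat set \<times> (nat \<Rightarrow> side)) set" where
  "signed_subsets d = {(I, \<sigma>). I \<noteq> {} \<and> I \<subseteq> {1..d} \<and> \<sigma> \<in> I \<rightarrow>\<^sub>E UNIV}"

definition tail_coeff ::
    "nat \<Rightarrow> (nat set \<times> (nat \<Rightarrow> side) \<Rightarrow> real) \<Rightarrow> nat set \<Rightarrow> (nat \<Rightarrow> side) \<Rightarrow> real" where
  "tail_coeff d w J \<tau> =
     (\<Sum>(I, \<sigma>) \<in> {(I, \<sigma>) \<in> signed_subsets d. J \<subseteq> I \<and> restrict \<sigma> J = \<tau>}. w (I, \<sigma>))"

abbreviation vec_space :: "nat \<Rightarrow> (nat \<Rightarrow> real) measure" where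
  "vec_space d \<equiv> Pi\<^sub>M {1..d} (\<lambda>_. borel)"

abbreviation unit_uniform :: "real measure" where
  "unit_uniform \<equiv> uniform_measure lborel {0..1}"

definition witness_base :: "nat \<Rightarrow> real \<Rightarrow> (nat \<Rightarrow> real) measure" where
  "witness_base d p0 =
     distr (Pi\<^sub>M {1..d} (\<lambda>_. unit_uniform)) (vec_space d)
       (\<lambda>v. \<lambda>i\<in>{1..d}. p0 + (1 - 2 * p0) * v i)"

text \<open>One variable \<open>z\<close> is shared by all coordinates in \<open>I\<close>; product measures encode the
  independence of \<open>z\<close> and the \<open>v i\<close>.\<close>

definition witness_component ::
    "nat \<Rightarrow> real \<Rightarrow> nat set \<Rightarrow> (nat \<Rightarrow> side) \<Rightarrow> (nat \<Rightarrow> real) measure" where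
  "witness_component d p0 I \<sigma> =
     distr (unit_uniform \<Otimes>\<^sub>M Pi\<^sub>M ({1..d} - I) (\<lambda>_. unit_uniform)) (vec_space d)
       (\<lambda>(z, v). \<lambda>i\<in>{1..d}.
          if i \<in> I then (case \<sigma> i of Lower \<Rightarrow> p0 * z | Upper \<Rightarrow> 1 - p0 * z)
          else p0 + (1 - 2 * p0) * v i)"

definition residual_mass :: "nat \<Rightarrow> real \<Rightarrow> (nat set \<times> (nat \<Rightarrow> side) \<Rightarrow> real) \<Rightarrow> real" where
  "residual_mass d p0 w = 1 - p0 * (\<Sum>(I, \<sigma>) \<in> signed_subsets d. w (I, \<sigma>))"

text \<open>There is no addition on the type of measures, so the mixture is given by its values;
  \<open>emeasure_witness_law\<close> shows that they are the values of the resulting measure.\<close>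

definition witness_law ::
    "nat \<Rightarrow> real \<Rightarrow> (nat set \<times> (nat \<Rightarrow> side) \<Rightarrow> real) \<Rightarrow> (nat \<Rightarrow> real) measure" where
  "witness_law d p0 w =
     measure_of (space (vec_space d)) (sets (vec_space d))
       (\<lambda>A. ennreal (residual_mass d p0 w) * emeasure (witness_base d p0) A
          + (\<Sum>(I, \<sigma>) \<in> signed_subsets d.
               ennreal (p0 * w (I, \<sigma>)) * emeasure (witness_component d p0 I \<sigma>) A))"

primrec depth :: "side \<Rightarrow> real \<Rightarrow> real" where
  "depth Lower u = u"
| "depth Upper u = 1 - u"

definition threshold_coeff ::
    "'a measure \<Rightarrow> ('a \<Rightarrow> nat \<Rightarrow> real) \<Rightarrow> real \<Rightarrow> nat set \<Rightarrow> (nat \<Rightarrow> side) \<Rightarrow> real" where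
  "threshold_coeff M U p J \<tau> =
     1 / p * measure M {\<omega> \<in> space M. \<forall>i\<in>J. depth (\<tau> i) (U \<omega> i) \<le> p}"

lemma sets_witness_base [simp]: "sets (witness_base d p0) = sets (vec_space d)"
  by (simp add: witness_base_def)

lemma sets_witness_component [simp]: "sets (witness_component d p0 I \<sigma>) = sets (vec_space d)"
  by (simp add: witness_component_def)

lemma sets_witness_law [simp, measurable_cong]: "sets (witness_law d p0 w) = sets (vec_space d)"
  by (simp add: witness_law_def sets.space_closed)

lemma space_witness_law [simp]: "space (witness_law d p0 w) = space (vec_space d)"
  by (rule sets_eq_imp_space_eq) simp

lemma finite_signed_subsets: "finite (signed_subsets d)"
proof (rule finite_subset)
  have "UNIV = {Lower, Upper}"
    using side.exhaust by auto
  then have fin: "finite (UNIV :: side set)"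
    by (metis finite.emptyI finite.insertI)
  show "signed_subsets d \<subseteq> Sigma (Pow {1..d}) (\<lambda>I. I \<rightarrow>\<^sub>E UNIV)"
    by (auto simp: signed_subsets_def)
  show "finite (Sigma (Pow {1..d}) (\<lambda>I. I \<rightarrow>\<^sub>E (UNIV :: side set)))"
    using fin by (intro finite_SigmaI finite_PiE) (auto intro: finite_subset)
qed

lemma emeasure_witness_law:
  assumes "A \<in> sets (vec_space d)"
  shows "emeasure (witness_law d p0 w) A =
     ennreal (residual_mass d p0 w) * emeasure (witness_base d p0) A
     + (\<Sum>(I, \<sigma>) \<in> signed_subsets d.
          ennreal (p0 * w (I, \<sigma>)) * emeasure (witness_component d p0 I \<sigma>) A)"
    (is "_ = ?f A")
proof (rule emeasure_measure_of[OF witness_law_def])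
  show "positive (sets (witness_law d p0 w)) ?f"
    by (simp add: positive_def case_prod_beta)
  show "countably_additive (sets (witness_law d p0 w)) ?f"
  proof (rule countably_additiveI)
    fix F :: "nat \<Rightarrow> (nat \<Rightarrow> real) set"
    assume F: "range F \<subseteq> sets (witness_law d p0 w)" "disjoint_family F"
    have base: "(\<Sum>n. emeasure (witness_base d p0) (F n)) = emeasure (witness_base d p0) (\<Union> (range F))"
      using F by (intro suminf_emeasure) auto
    have comp: "(\<Sum>n. emeasure (witness_component d p0 I \<sigma>) (F n))
        = emeasure (witness_component d p0 I \<sigma>) (\<Union> (range F))" for I \<sigma>
      using F by (intro suminf_emeasure) auto
    have "(\<Sum>n. ?f (F n)) =
        (\<Sum>n. ennreal (residual_mass d p0 w) * emeasure (witness_base d p0) (F n))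
        + (\<Sum>n. \<Sum>(I, \<sigma>) \<in> signed_subsets d.
             ennreal (p0 * w (I, \<sigma>)) * emeasure (witness_component d p0 I \<sigma>) (F n))"
      by (intro suminf_add[symmetric] summableI)
    also have "\<dots> = ?f (\<Union> (range F))"
      by (simp add: case_prod_beta suminf_sum base comp)
    finally show "(\<Sum>n. ?f (F n)) = ?f (\<Union> (range F))" .
  qed
qed (use assms sets.space_closed in \<open>auto simp: sets.space_closed\<close>)

lemma prob_space_unit_uniform: "prob_space unit_uniform"
  by (rule prob_space_uniform_measure) auto

lemma prob_space_witness_base: "prob_space (witness_base d p0)"
  unfolding witness_base_def
  by (intro prob_space.prob_space_distr prob_space_PiM prob_space_unit_uniform) measurable

lemma prob_space_witness_component: "prob_space (witness_component d p0 I \<sigma>)"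
proof -
  interpret Z: prob_space unit_uniform by (rule prob_space_unit_uniform)
  interpret V: prob_space "Pi\<^sub>M ({1..d} - I) (\<lambda>_. unit_uniform)"
    by (intro prob_space_PiM prob_space_unit_uniform)
  interpret P: pair_prob_space unit_uniform "Pi\<^sub>M ({1..d} - I) (\<lambda>_. unit_uniform)" ..
  have *: "(\<lambda>x. if i \<in> I then (case \<sigma> i of Lower \<Rightarrow> p0 * fst x | Upper \<Rightarrow> 1 - p0 * fst x)
          else p0 + (1 - 2 * p0) * snd x i)
      \<in> borel_measurable (unit_uniform \<Otimes>\<^sub>M Pi\<^sub>M ({1..d} - I) (\<lambda>_. unit_uniform))"
    if "i \<in> {1..d}" for i
  proof (cases "i \<in> I")
    case True
    then show ?thesis by (cases "\<sigma> i") simp_all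
  next
    case False
    with that have "i \<in> {1..d} - I" by simp
    then show ?thesis using False by simp measurable
  qed
  show ?thesis
    unfolding witness_component_def case_prod_beta
    by (intro P.prob_space_distr measurable_restrict *)
qed

lemma prob_space_witness_law:
  assumes "0 < p0" "\<And>I \<sigma>. (I, \<sigma>) \<in> signed_subsets d \<Longrightarrow> 0 \<le> w (I, \<sigma>)"
    and "0 \<le> residual_mass d p0 w"
  shows "prob_space (witness_law d p0 w)"
proof (rule prob_spaceI)
  have base: "emeasure (witness_base d p0) (space (vec_space d)) = 1"
    using prob_space.emeasure_space_1[OF prob_space_witness_base]
    by (metis sets_eq_imp_space_eq sets_witness_base)
  have comp: "emeasure (witness_component d p0 I \<sigma>) (space (vec_space d)) = 1" for I \<sigma>
    using prob_space.emeasure_space_1[OF prob_space_witness_component]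
    by (metis sets_eq_imp_space_eq sets_witness_component)
  have "(\<Sum>x \<in> signed_subsets d. ennreal (p0 * w x)) = ennreal (\<Sum>x \<in> signed_subsets d. p0 * w x)"
    using assms by (intro sum_ennreal) auto
  moreover have "0 \<le> (\<Sum>x \<in> signed_subsets d. p0 * w x)"
    using assms by (intro sum_nonneg) auto
  moreover have "residual_mass d p0 w + (\<Sum>x \<in> signed_subsets d. p0 * w x) = 1"
    by (simp add: residual_mass_def sum_distrib_left case_prod_beta)
  ultimately show "emeasure (witness_law d p0 w) (space (witness_law d p0 w)) = 1"
    using assms(3)
    by (simp add: emeasure_witness_law base[simplified] comp[simplified] case_prod_beta flip: ennreal_plus)
qed

end

theory Submission imports Defs
begin

text \<open>
  Membership of a point in a tail event is decided component by component of the mixture.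
  Call the depth of coordinate \<open>i\<close> its distance to the face of the cube that \<open>\<tau> i\<close> selects.
  A coordinate outside \<open>I\<close> almost surely lies in the open central interval
  \<open>(p0, 1 - p0)\<close>, so its depth exceeds \<open>p0\<close> on both sides; a coordinate of \<open>I\<close> lies within \<open>p0\<close> of the face chosen
  by \<open>\<sigma>\<close> and, because \<open>p0 < 1 / 2\<close>, its depth with respect to the opposite face again
  exceeds \<open>p0\<close>. Hence for \<open>p \<le> p0\<close> the tail event of \<open>(J, \<tau>)\<close> is null under the component
  \<open>(I, \<sigma>)\<close> unless \<open>J \<subseteq> I\<close> and \<open>\<sigma>\<close> extends \<open>\<tau>\<close>. In the remaining case all coordinates in \<open>J\<close>
  share the single depth \<open>p0 * z\<close>, so the event is just \<open>z \<le> p / p0\<close>, of probability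
  \<open>p / p0\<close> (\<open>emeasure_witness_component_tail\<close>). The base component has only central
  coordinates and contributes nothing (\<open>emeasure_witness_base_tail\<close>). The mixture weight \<open>p0 * w (I, \<sigma>)\<close> cancels
  the scale \<open>p0\<close>, and the normalisation \<open>1 / p\<close> cancels \<open>p\<close>: the coefficient does not depend
  on the threshold.
\<close>

section \<open>Tail events and depths\<close>

(* Keeps the index set in the form {1..d}, in which the simplification rules for the witness
   measures are stated. *)
declare One_nat_def [simp del]

definition tail_event :: "nat \<Rightarrow> nat set \<Rightarrow> (nat \<Rightarrow> side) \<Rightarrow> real \<Rightarrow> (nat \<Rightarrow> real) set" where
  "tail_event d J \<tau> p = {x \<in> space (vec_space d). \<forall>i\<in>J. depth (\<tau> i) (x i) \<le> p}"

lemma sets_tail_event: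
  assumes "J \<subseteq> {1..d}"
  shows "tail_event d J \<tau> p \<in> sets (vec_space d)"
proof -
  have [measurable]: "(\<lambda>x. depth (\<tau> i) (x i)) \<in> borel_measurable (vec_space d)" if "i \<in> J" for i
  proof -
    have i: "i \<in> {1..d}"
      using that assms by auto
    then have [measurable]: "(\<lambda>x. x i) \<in> borel_measurable (vec_space d)"
      by (rule measurable_component_singleton)
    show ?thesis
      by (cases "\<tau> i") simp_all
  qed
  have "finite J"
    using assms finite_subset by blast
  then have [measurable]: "countable J"
    by (rule countable_finite)
  show ?thesis
    unfolding tail_event_def
    by measurable
qed

lemma AE_unit_uniform: "AE z in unit_uniform. 0 < z \<and> z < 1"
proof (rule AE_uniform_measureI)
  show "AE z in lborel. z \<in> {0..1} \<longrightarrow> 0 < z \<and> z < (1 :: real)"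
    using AE_lborel_singleton[of 0] AE_lborel_singleton[of 1] by eventually_elim auto
qed simp

lemma emeasure_unit_uniform_atMost:
  assumes "0 \<le> c" and "c \<le> 1"
  shows "emeasure unit_uniform {..c} = ennreal c"
proof -
  have "{0..1} \<inter> {..c} = {0..c}"
    using assms by auto
  then show ?thesis
    using assms by (simp add: divide_ennreal_def)
qed

text \<open>The end points of the range of \<open>v\<close> have to be excluded: at one of them the depth equals
  \<open>p0\<close>, and for \<open>p = p0\<close> the condition of the tail event on this coordinate would hold. They
  carry no mass, which is why the claims about the components hold up to the largest threshold \<open>p = p0\<close>.\<close>

lemma depth_central_gt:
  assumes "p0 < 1 / 2" and "0 < v" and "v < 1"
  shows "p0 < depth s (p0 + (1 - 2 * p0) * v)"
proof -
  have "0 < (1 - 2 * p0) * v" and "0 < (1 - 2 * p0) * (1 - v)"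
    using assms by simp_all
  then show ?thesis
    by (cases s) (simp_all add: algebra_simps)
qed

lemma depth_near_face:
  "depth s (case t of Lower \<Rightarrow> q | Upper \<Rightarrow> 1 - q) = (if s = t then q else 1 - q)"
  by (cases s; cases t) simp_all

section \<open>Tail probabilities of the mixture components\<close>

lemma emeasure_witness_base_tail:
  assumes "p0 < 1 / 2" and "p \<le> p0" and "J \<noteq> {}" and "J \<subseteq> {1..d}"
  shows "emeasure (witness_base d p0) (tail_event d J \<tau> p) = 0"
proof -
  let ?V = "Pi\<^sub>M {1..d} (\<lambda>_. unit_uniform)"
  let ?f = "\<lambda>v. \<lambda>i\<in>{1..d}. p0 + (1 - 2 * p0) * v i"
  obtain i where i: "i \<in> J" "i \<in> {1..d}"
    using assms(3,4) by blast
  have "AE v in ?V. 0 < v i \<and> v i < 1"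
    using i by (intro AE_PiM_component prob_space_unit_uniform AE_unit_uniform)
  then have "AE v in ?V. ?f v \<notin> tail_event d J \<tau> p"
  proof eventually_elim
    case (elim v)
    then have "p0 < depth (\<tau> i) (?f v i)"
      using assms(1) i by (simp add: depth_central_gt)
    with assms(2) i show ?case
      by (force simp: tail_event_def)
  qed
  moreover have f: "?f \<in> ?V \<rightarrow>\<^sub>M vec_space d"
    by measurable
  ultimately have "AE x in witness_base d p0. x \<notin> tail_event d J \<tau> p"
    unfolding witness_base_def using sets_tail_event[OF assms(4)]
    by (subst AE_distr_iff) auto
  then show ?thesis
    using sets_tail_event[OF assms(4)]
    by (subst (asm) AE_iff_measurable[where N = "tail_event d J \<tau> p"])
      (auto dest: sets.sets_into_space simp: sets_eq_imp_space_eq[OF sets_witness_base])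
qed

lemma measurable_witness_map:
  "(\<lambda>(z, v). \<lambda>i\<in>{1..d}.
      if i \<in> I then (case \<sigma> i of Lower \<Rightarrow> p0 * z | Upper \<Rightarrow> 1 - p0 * z)
      else p0 + (1 - 2 * p0) * v i)
    \<in> unit_uniform \<Otimes>\<^sub>M Pi\<^sub>M ({1..d} - I) (\<lambda>_. unit_uniform) \<rightarrow>\<^sub>M vec_space d"
  unfolding case_prod_beta
proof (intro measurable_restrict)
  fix i assume i: "i \<in> {1..d}"
  show "(\<lambda>x. if i \<in> I then (case \<sigma> i of Lower \<Rightarrow> p0 * fst x | Upper \<Rightarrow> 1 - p0 * fst x)
          else p0 + (1 - 2 * p0) * snd x i)
      \<in> borel_measurable (unit_uniform \<Otimes>\<^sub>M Pi\<^sub>M ({1..d} - I) (\<lambda>_. unit_uniform))"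
  proof (cases "i \<in> I")
    case True
    then show ?thesis by (cases "\<sigma> i") simp_all
  next
    case False
    with i have "i \<in> {1..d} - I" by simp
    then show ?thesis using False by simp measurable
  qed
qed

text \<open>Outside a null set the tail event is, as a condition on \<open>(z, v)\<close>, either impossible or the
  single inequality \<open>z \<le> p / p0\<close>: the coordinates in \<open>I\<close> are perfectly dependent, so
  no power of \<open>p\<close> higher than the first appears, however large \<open>J\<close> is.\<close>

lemma emeasure_witness_component_tail:
  assumes p0: "0 < p0" "p0 < 1 / 2" and p: "0 < p" "p \<le> p0"
    and J: "J \<noteq> {}" "J \<subseteq> {1..d}" and \<tau>: "\<tau> \<in> J \<rightarrow>\<^sub>E UNIV"
  shows "emeasure (witness_component d p0 I \<sigma>) (tail_event d J \<tau> p) =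
    ennreal (if J \<subseteq> I \<and> restrict \<sigma> J = \<tau> then p / p0 else 0)"
proof -
  let ?V = "Pi\<^sub>M ({1..d} - I) (\<lambda>_. unit_uniform)"
  let ?P = "unit_uniform \<Otimes>\<^sub>M ?V"
  let ?f = "\<lambda>(z :: real, v :: nat \<Rightarrow> real). \<lambda>i\<in>{1..d}.
      if i \<in> I then (case \<sigma> i of Lower \<Rightarrow> p0 * z | Upper \<Rightarrow> 1 - p0 * z)
      else p0 + (1 - 2 * p0) * v i"
  let ?E = "tail_event d J \<tau> p"
  interpret Z: prob_space unit_uniform
    by (rule prob_space_unit_uniform)
  interpret V: prob_space ?V
    by (intro prob_space_PiM prob_space_unit_uniform)
  interpret ZV: pair_prob_space unit_uniform ?V ..
  define match where "match \<longleftrightarrow> J \<subseteq> I \<and> restrict \<sigma> J = \<tau>"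
  have match_iff: "match \<longleftrightarrow> (\<forall>i\<in>J. i \<in> I \<and> \<sigma> i = \<tau> i)"
    using \<tau> by (auto simp: match_def fun_eq_iff PiE_def extensional_def restrict_def)
  have AE_z: "AE x in ?P. 0 < fst x \<and> fst x < 1"
    by (rule AE_distrD[OF measurable_fst]) (subst V.distr_pair_fst, rule AE_unit_uniform)
  have AE_v: "AE x in ?P. 0 < snd x i \<and> snd x i < 1" if "i \<in> {1..d} - I" for i
  proof -
    have "AE v in ?V. 0 < v i \<and> v i < 1"
      using that by (intro AE_PiM_component prob_space_unit_uniform AE_unit_uniform)
    moreover have "{x \<in> space ?P. 0 < snd x i \<and> snd x i < 1} \<in> sets ?P"
      using that by measurable
    ultimately show ?thesis
      by (intro ZV.AE_pair_measure) auto
  qed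
  have AE_v_all: "AE x in ?P. \<forall>i\<in>{1..d} - I. 0 < snd x i \<and> snd x i < 1"
    by (intro AE_finite_allI AE_v) auto
  (* The right-hand side does not mention J: every i in J imposes the same condition on z, and
     J is nonempty, so it is imposed at least once. *)
  have event_iff: "AE x in ?P. ?f x \<in> ?E \<longleftrightarrow> match \<and> fst x \<le> p / p0"
    using AE_space AE_z AE_v_all
  proof eventually_elim
    case (elim x)
    have depth_iff: "depth (\<tau> i) (?f x i) \<le> p \<longleftrightarrow> i \<in> I \<and> \<sigma> i = \<tau> i \<and> fst x \<le> p / p0"
      if "i \<in> J" for i
    proof (cases "i \<in> I")
      case True
      have "p0 * fst x < p0"
        using elim p0 by simp
      then have "\<not> 1 - p0 * fst x \<le> p"
        using p0 p by linarith
      moreover have "p0 * fst x \<le> p \<longleftrightarrow> fst x \<le> p / p0"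
        using p0 by (simp add: pos_le_divide_eq mult.commute)
      moreover have "i \<in> {1..d}"
        using that J by auto
      ultimately show ?thesis
        using True by (auto simp: case_prod_beta depth_near_face)
    next
      case False
      moreover have "i \<in> {1..d}"
        using that J by auto
      ultimately have "p0 < depth (\<tau> i) (?f x i)"
        using elim p0 by (auto simp: case_prod_beta intro!: depth_central_gt)
      with False p show ?thesis
        by simp
    qed
    have "?f x \<in> space (vec_space d)"
      by (rule measurable_space[OF measurable_witness_map]) (use elim in simp)
    then have "?f x \<in> ?E \<longleftrightarrow> (\<forall>i\<in>J. i \<in> I \<and> \<sigma> i = \<tau> i \<and> fst x \<le> p / p0)"
      using depth_iff by (simp add: tail_event_def del: split_beta)
    with J(1) show ?case
      by (auto simp: match_iff)
  qed
  have E: "?E \<in> sets (vec_space d)"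
    by (rule sets_tail_event[OF J(2)])
  have "emeasure (witness_component d p0 I \<sigma>) ?E = emeasure ?P (?f -` ?E \<inter> space ?P)"
    unfolding witness_component_def by (rule emeasure_distr[OF measurable_witness_map E])
  also have "\<dots> = emeasure ?P {x \<in> space ?P. match \<and> fst x \<le> p / p0}"
  proof (rule emeasure_eq_AE)
    show "AE x in ?P. x \<in> ?f -` ?E \<inter> space ?P \<longleftrightarrow> x \<in> {x \<in> space ?P. match \<and> fst x \<le> p / p0}"
      using event_iff by eventually_elim auto
    show "?f -` ?E \<inter> space ?P \<in> sets ?P"
      by (rule measurable_sets[OF measurable_witness_map E])
  qed measurable
  also have "\<dots> = ennreal (if match then p / p0 else 0)"
  proof (cases match)
    case True
    have "{x \<in> space ?P. match \<and> fst x \<le> p / p0} = fst -` {..p / p0} \<inter> space ?P"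
      using True by auto
    then have "emeasure ?P {x \<in> space ?P. match \<and> fst x \<le> p / p0} =
        emeasure (distr ?P unit_uniform fst) {..p / p0}"
      by (subst emeasure_distr) auto
    also have "\<dots> = ennreal (p / p0)"
      using p0 p by (subst V.distr_pair_fst) (rule emeasure_unit_uniform_atMost; simp)
    finally show ?thesis
      using True by simp
  qed simp
  finally show ?thesis
    by (simp add: match_def)
qed

section \<open>Tail probabilities of the mixture\<close>

text \<open>A component that matches \<open>(J, \<tau>)\<close> contributes \<open>p0 * w (I, \<sigma>) * (p / p0)\<close>; every
  such contribution is linear in \<open>p\<close>, hence so is the whole tail probability.\<close>

lemma measure_witness_law_tail:
  assumes p0: "0 < p0" "p0 < 1 / 2" and p: "0 < p" "p \<le> p0"
    and w: "\<And>I \<sigma>. (I, \<sigma>) \<in> signed_subsets d \<Longrightarrow> 0 \<le> w (I, \<sigma>)"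
    and J: "J \<noteq> {}" "J \<subseteq> {1..d}" and \<tau>: "\<tau> \<in> J \<rightarrow>\<^sub>E UNIV"
  shows "measure (witness_law d p0 w) (tail_event d J \<tau> p) = p * tail_coeff d w J \<tau>"
proof -
  let ?S = "signed_subsets d"
  let ?ext = "\<lambda>x. J \<subseteq> fst x \<and> restrict (snd x) J = \<tau>"
  have w': "0 \<le> w x" if "x \<in> ?S" for x
    using w[of "fst x" "snd x"] that by simp
  have "emeasure (witness_law d p0 w) (tail_event d J \<tau> p) =
      (\<Sum>x \<in> ?S. ennreal (p0 * w x) * ennreal (if ?ext x then p / p0 else 0))"
    using assms
    by (simp add: emeasure_witness_law sets_tail_event emeasure_witness_base_tail
        emeasure_witness_component_tail case_prod_beta)
  also have "\<dots> = (\<Sum>x \<in> ?S. ennreal (if ?ext x then p * w x else 0))"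
    using p0 p w' by (intro sum.cong) (auto simp flip: ennreal_mult)
  also have "\<dots> = ennreal (\<Sum>x \<in> ?S. if ?ext x then p * w x else 0)"
    using p w' by (intro sum_ennreal) auto
  also have "(\<Sum>x \<in> ?S. if ?ext x then p * w x else 0) = p * tail_coeff d w J \<tau>"
  proof -
    have "{x \<in> ?S. ?ext x} = {(I, \<sigma>) \<in> ?S. J \<subseteq> I \<and> restrict \<sigma> J = \<tau>}"
      by auto
    then show ?thesis
      by (simp add: tail_coeff_def sum_distrib_left case_prod_beta finite_signed_subsets
          flip: sum.inter_filter)
  qed
  finally have "emeasure (witness_law d p0 w) (tail_event d J \<tau> p) =
      ennreal (p * tail_coeff d w J \<tau>)" .
  moreover have "0 \<le> p * tail_coeff d w J \<tau>"
    using p w' unfolding tail_coeff_def by (intro mult_nonneg_nonneg sum_nonneg) auto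
  ultimately show ?thesis
    by (simp add: measure_def)
qed

lemma tail_coeff_eq_iterated_sum:
  assumes "J \<noteq> {}"
  shows "tail_coeff d w J \<tau> =
    (\<Sum>I \<in> {I. J \<subseteq> I \<and> I \<subseteq> {1..d}}.
       \<Sum>\<sigma> \<in> {\<sigma> \<in> I \<rightarrow>\<^sub>E UNIV. restrict \<sigma> J = \<tau>}. w (I, \<sigma>))"
proof -
  let ?A = "{I. J \<subseteq> I \<and> I \<subseteq> {1..d}}"
  let ?B = "\<lambda>I. {\<sigma> \<in> I \<rightarrow>\<^sub>E UNIV. restrict \<sigma> J = \<tau>}"
  have finA: "finite ?A"
    by (rule finite_subset[of _ "Pow {1..d}"]) auto
  have "finite (?B I)" if "I \<in> ?A" for I
  proof (rule finite_subset)
    show "?B I \<subseteq> snd ` signed_subsets d"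
    proof
      fix \<sigma> assume "\<sigma> \<in> ?B I"
      with that assms have "(I, \<sigma>) \<in> signed_subsets d"
        unfolding signed_subsets_def by blast
      then show "\<sigma> \<in> snd ` signed_subsets d"
        by (metis imageI snd_conv)
    qed
    show "finite (snd ` signed_subsets d)"
      by (simp add: finite_signed_subsets)
  qed
  then have "(\<Sum>I\<in>?A. \<Sum>\<sigma>\<in>?B I. w (I, \<sigma>)) = (\<Sum>(I, \<sigma>)\<in>Sigma ?A ?B. w (I, \<sigma>))"
    using finA by (intro sum.Sigma) auto
  also have "Sigma ?A ?B = {(I, \<sigma>) \<in> signed_subsets d. J \<subseteq> I \<and> restrict \<sigma> J = \<tau>}"
    using assms by (auto simp: signed_subsets_def)
  finally show ?thesis
    unfolding tail_coeff_def by (rule sym)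
qed

lemma threshold_coeff_eq_measure_distr:
  assumes "U \<in> M \<rightarrow>\<^sub>M vec_space d" and "J \<subseteq> {1..d}"
  shows "threshold_coeff M U p J \<tau> = 1 / p * measure (distr M (vec_space d) U) (tail_event d J \<tau> p)"
proof -
  have "U -` tail_event d J \<tau> p \<inter> space M = {\<omega> \<in> space M. \<forall>i\<in>J. depth (\<tau> i) (U \<omega> i) \<le> p}"
    using measurable_space[OF assms(1)] by (auto simp: tail_event_def)
  then show ?thesis
    using assms by (simp add: threshold_coeff_def measure_distr sets_tail_event)
qed

theorem corollary7:
  fixes d :: nat and p0 :: real
    and w :: "nat set \<times> (nat \<Rightarrow> side) \<Rightarrow> real"
    and M :: "'a measure" and U :: "'a \<Rightarrow> nat \<Rightarrow> real"
  assumes "1 \<le> d" and "0 < p0" and "p0 < 1 / 2"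
    and "\<And>I \<sigma>. (I, \<sigma>) \<in> signed_subsets d \<Longrightarrow> 0 \<le> w (I, \<sigma>)"
    and "0 \<le> residual_mass d p0 w"
    and "prob_space M"
    and "U \<in> M \<rightarrow>\<^sub>M vec_space d"
    and "distr M (vec_space d) U = witness_law d p0 w"
  shows "(\<forall>J \<tau> p. J \<noteq> {} \<and> J \<subseteq> {1..d} \<and> \<tau> \<in> J \<rightarrow>\<^sub>E UNIV \<and> 0 < p \<and> p \<le> p0 \<longrightarrow>
            threshold_coeff M U p J \<tau> =
              (\<Sum>I \<in> {I. J \<subseteq> I \<and> I \<subseteq> {1..d}}.
                 \<Sum>\<sigma> \<in> {\<sigma> \<in> I \<rightarrow>\<^sub>E UNIV. restrict \<sigma> J = \<tau>}. w (I, \<sigma>)) \<and>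
            (\<Sum>I \<in> {I. J \<subseteq> I \<and> I \<subseteq> {1..d}}.
                 \<Sum>\<sigma> \<in> {\<sigma> \<in> I \<rightarrow>\<^sub>E UNIV. restrict \<sigma> J = \<tau>}. w (I, \<sigma>)) = tail_coeff d w J \<tau>)
       \<and> (\<forall>p. 0 < p \<and> p \<le> p0 \<longrightarrow>
            (\<lambda>(J, \<tau>) \<in> signed_subsets d. threshold_coeff M U p J \<tau>) =
            (\<lambda>(J, \<tau>) \<in> signed_subsets d. tail_coeff d w J \<tau>))"
proof -
  have coeff: "threshold_coeff M U p J \<tau> = tail_coeff d w J \<tau>"
    if "J \<noteq> {}" "J \<subseteq> {1..d}" "\<tau> \<in> J \<rightarrow>\<^sub>E UNIV" "0 < p" "p \<le> p0" for J \<tau> p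
    using that assms by (simp add: threshold_coeff_eq_measure_distr measure_witness_law_tail)
  then show ?thesis
    by (auto simp: tail_coeff_eq_iterated_sum[symmetric] signed_subsets_def
        intro!: restrict_ext)
qed

end
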